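(* Let $A$ be a $\mathcal{C}^\infty$-field and let $\prec_A$ be the canonical strict partial order on $A$. Write $a\preceq b$ iff $a\prec_A b$ or $a=b$. Then $(A,\preceq)$ is a totally ordered field, i.e. $\preceq$ is a reflexive, transitive and anti-symmetric binary relation on $A$ that is compatible with sum and product and, moreover, the trichotomy law holds: for every $a,b\in A$ exactly one of $a=b$, $a\prec_A b$, $b\prec_A a$ holds.
   Context: A $\mathcal{C}^\infty$-ring is a set $A$ together with an operation $f^A:A^n\to A$ for every $n\in\mathbb{N}$ and every smooth $f:\mathbb{R}^n\to\mathbb{R}$, such that coordinate projections are interpreted as projections and $f=h\circ(g_1,\dots,g_n)$ implies $f^A=h^A\circ(g_1^A,\dots,g_n^A)$. It has an underlying commutative unital ring (an $\mathbb{R}$-algebra). A $\mathcal{C}^\infty$-field is a $\mathcal{C}^\infty$-ring whose underlying ring is a field. $A^\times$ denotes the group of invertible elements. The canonical relation on a $\mathcal{C}^\infty$-ring $A$ is: $a\prec_A b$ iff there exists $u\in A^\times$ with $b-a=u^2$. Compatibility of $\preceq$ with sum and product means: $a\preceq b$ implies $a+x\preceq b+x$ for all $x$, and $a\preceq b$, $0\preceq x$ imply $ax\preceq bx$. *)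

theory Defs
  imports "HOL-Analysis.Analysis" "HOL-Algebra.Ring"
begin

text \<open>An \<open>n\<close>-tuple over \<open>X\<close> is an extensional function on \<open>{..<n}\<close>; thus there is exactly one
  \<open>0\<close>-tuple, and the \<open>0\<close>-ary operations of a structure are its constants.\<close>

abbreviation tuples :: "nat \<Rightarrow> 'a set \<Rightarrow> (nat \<Rightarrow> 'a) set"
  where "tuples n X \<equiv> {..<n} \<rightarrow>\<^sub>E X"

abbreviation RR :: "nat \<Rightarrow> (nat \<Rightarrow> real) set"
  where "RR n \<equiv> tuples n UNIV"

text \<open>\<open>Ck k n f\<close>: on \<open>RR n\<close>, all partial derivatives of \<open>f\<close> of order at most \<open>k\<close> exist and are
  continuous. The topology \<open>powertop_real {..<n}\<close> has carrier \<open>RR n\<close>.\<close>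

primrec Ck :: "nat \<Rightarrow> nat \<Rightarrow> ((nat \<Rightarrow> real) \<Rightarrow> real) \<Rightarrow> bool" where
  "Ck 0 n f \<longleftrightarrow> continuous_map (powertop_real {..<n}) euclideanreal f"
| "Ck (Suc k) n f \<longleftrightarrow>
     continuous_map (powertop_real {..<n}) euclideanreal f \<and>
     (\<forall>i<n. \<exists>f'. Ck k n f' \<and>
        (\<forall>x\<in>RR n. ((\<lambda>t. f (x(i := t))) has_real_derivative f' x) (at (x i))))"

text \<open>Requiring \<open>f\<close> to be extensional makes each smooth map from \<open>RR n\<close> to the reals
  correspond to exactly one HOL function.\<close>

definition smooth :: "nat \<Rightarrow> ((nat \<Rightarrow> real) \<Rightarrow> real) \<Rightarrow> bool"
  where "smooth n f \<longleftrightarrow> f \<in> extensional (RR n) \<and> (\<forall>k. Ck k n f)"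

record 'a cinf_structure = "'a partial_object" +
  interp :: "nat \<Rightarrow> ((nat \<Rightarrow> real) \<Rightarrow> real) \<Rightarrow> (nat \<Rightarrow> 'a) \<Rightarrow> 'a"

text \<open>In \<open>interp_comp\<close> the composite is again smooth, by the chain rule.\<close>

locale cinf_ring =
  fixes A :: "'a cinf_structure"
  assumes interp_closed:
      "smooth n f \<Longrightarrow> a \<in> tuples n (carrier A) \<Longrightarrow> interp A n f a \<in> carrier A"
    and interp_proj:
      "i < n \<Longrightarrow> a \<in> tuples n (carrier A) \<Longrightarrow> interp A n (\<lambda>x\<in>RR n. x i) a = a i"
    and interp_comp:
      "smooth n h \<Longrightarrow> (\<And>i. i < n \<Longrightarrow> smooth m (g i)) \<Longrightarrow> a \<in> tuples m (carrier A) \<Longrightarrow>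
       interp A m (\<lambda>x\<in>RR m. h (\<lambda>i\<in>{..<n}. g i x)) a =
       interp A n h (\<lambda>i\<in>{..<n}. interp A m (g i) a)"

definition pair :: "'a \<Rightarrow> 'a \<Rightarrow> nat \<Rightarrow> 'a"
  where "pair a b = (\<lambda>i\<in>{..<2}. if i = 0 then a else b)"

definition underlying_ring :: "'a cinf_structure \<Rightarrow> 'a ring"
  where "underlying_ring A =
    \<lparr> carrier = carrier A,
      mult = (\<lambda>a b. interp A 2 (\<lambda>x\<in>RR 2. x 0 * x 1) (pair a b)),
      one = interp A 0 (\<lambda>x\<in>RR 0. 1) (\<lambda>i. undefined),
      zero = interp A 0 (\<lambda>x\<in>RR 0. 0) (\<lambda>i. undefined),
      add = (\<lambda>a b. interp A 2 (\<lambda>x\<in>RR 2. x 0 + x 1) (pair a b)) \<rparr>"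

locale cinf_field = cinf_ring +
  assumes field_underlying_ring: "field (underlying_ring A)"

definition cinf_less :: "'a cinf_structure \<Rightarrow> 'a \<Rightarrow> 'a \<Rightarrow> bool"
  where "cinf_less A a b \<longleftrightarrow>
    (\<exists>u \<in> Units (underlying_ring A).
       b \<ominus>\<^bsub>underlying_ring A\<^esub> a = u [^]\<^bsub>underlying_ring A\<^esub> (2::nat))"

definition cinf_le :: "'a cinf_structure \<Rightarrow> 'a \<Rightarrow> 'a \<Rightarrow> bool"
  where "cinf_le A a b \<longleftrightarrow> cinf_less A a b \<or> a = b"

end

theory Submission
  imports Defs "HOL-Algebra.Multiplicative_Group"
begin

text \<open>
  Two smooth functions of one variable suffice. The positive function
  \<open>\<tau>(x) = 1 / sqrt (1 + x\<^sup>2)\<close> satisfies \<open>(1 + x\<^sup>2) \<tau>(x)\<^sup>2 = 1\<close>, so in a \<open>C\<^sup>\<infinity>\<close>-field every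
  \<open>1 + w\<^sup>2\<close> is the square of a unit, and hence so is every sum of two squares of units: this is
  transitivity. For totality, \<open>\<rho>(x) = sqrt (x + sqrt (1 + x\<^sup>2))\<close> satisfies
  \<open>\<rho>\<^sup>4 = 2 x \<rho>\<^sup>2 + 1\<close>. Given \<open>a \<noteq> 0\<close>, put \<open>b = 1 / a\<close> and \<open>r = \<rho>((a - b) / 2)\<close>; the equation becomes
  \<open>(r\<^sup>2 - a) (r\<^sup>2 + b) = 0\<close>, so either \<open>a = r\<^sup>2\<close> or \<open>- a = (a r)\<^sup>2\<close>.

  Both functions are smooth because their derivatives, \<open>- x \<tau>\<^sup>3\<close> and \<open>\<rho> \<tau> / 2\<close>, are again
  polynomials in \<open>x\<close>, \<open>\<tau>\<close> and \<open>\<rho>\<close>.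
\<close>

section \<open>Closure properties of the classes \<open>Ck\<close>\<close>

lemma fun_upd_RR: "x \<in> RR n \<Longrightarrow> i < n \<Longrightarrow> x(i := t) \<in> RR n"
  by (auto simp: PiE_def extensional_def)

lemma Ck_continuous: "Ck k n f \<Longrightarrow> continuous_map (powertop_real {..<n}) euclideanreal f"
  by (cases k) auto

lemma Ck_partial:
  assumes "Ck (Suc k) n f" "i < n"
  obtains f' where "Ck k n f'"
    "\<And>x. x \<in> RR n \<Longrightarrow> ((\<lambda>t. f (x(i := t))) has_real_derivative f' x) (at (x i))"
  using assms by auto

text \<open>By induction, applied to the partial derivatives. The product rule needs this: its terms
  pair a derivative with an undifferentiated factor, whose order has to be lowered by one.\<close>

lemma Ck_lower: "Ck (Suc k) n f \<Longrightarrow> Ck k n f"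
proof (induction k arbitrary: f)
  case (Suc k)
  then show ?case
    by (subst Ck.simps(2)) (metis Ck.simps(2))
qed simp

text \<open>Partial derivatives at a point of \<open>RR n\<close> only see updates at indices below
  \<open>n\<close>, and these stay inside \<open>RR n\<close>. Hence restricting a function to
  \<open>RR n\<close> does not affect \<open>Ck\<close>.\<close>

lemma Ck_cong:
  assumes "\<And>x. x \<in> RR n \<Longrightarrow> f x = g x"
  shows "Ck k n f \<longleftrightarrow> Ck k n g"
proof -
  have "continuous_map (powertop_real {..<n}) euclideanreal f \<longleftrightarrow>
        continuous_map (powertop_real {..<n}) euclideanreal g"
    by (rule iffI; erule continuous_map_eq) (use assms in auto)
  moreover have "(\<lambda>t. f (x(i := t))) = (\<lambda>t. g (x(i := t)))" if "x \<in> RR n" "i < n" for x i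
    using assms fun_upd_RR[OF that] by auto
  ultimately show ?thesis
    by (cases k) auto
qed

lemma Ck_const: "Ck k n (\<lambda>x. c)"
proof (induction k arbitrary: c)
  case (Suc k)
  then show ?case
    by (auto intro!: exI[of _ "\<lambda>x. 0"] derivative_eq_intros)
qed simp

lemma Ck_proj: "j < n \<Longrightarrow> Ck k n (\<lambda>x. x j)"
proof (induction k)
  case (Suc k)
  have "\<exists>f'. Ck k n f' \<and>
      (\<forall>x\<in>RR n. ((\<lambda>t. (x(i := t)) j) has_real_derivative f' x) (at (x i)))" for i
    by (rule exI[of _ "\<lambda>x. if i = j then 1 else 0"])
      (cases "i = j"; auto intro!: derivative_eq_intros simp: Ck_const)
  with Suc Ck_continuous show ?case
    by simp
qed (simp, rule continuous_map_product_coordinates, simp)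

lemma Ck_add: "Ck k n f \<Longrightarrow> Ck k n g \<Longrightarrow> Ck k n (\<lambda>x. f x + g x)"
proof (induction k arbitrary: f g)
  case (Suc k)
  have "\<exists>h'. Ck k n h' \<and> (\<forall>x\<in>RR n.
      ((\<lambda>t. f (x(i := t)) + g (x(i := t))) has_real_derivative h' x) (at (x i)))"
    if i: "i < n" for i
  proof -
    obtain f' where f': "Ck k n f'"
      "\<And>x. x \<in> RR n \<Longrightarrow> ((\<lambda>t. f (x(i := t))) has_real_derivative f' x) (at (x i))"
      using Ck_partial[OF Suc.prems(1) i] by blast
    obtain g' where g': "Ck k n g'"
      "\<And>x. x \<in> RR n \<Longrightarrow> ((\<lambda>t. g (x(i := t))) has_real_derivative g' x) (at (x i))"
      using Ck_partial[OF Suc.prems(2) i] by blast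
    show ?thesis
      by (intro exI[of _ "\<lambda>x. f' x + g' x"] conjI Suc.IH ballI DERIV_add f' g')
  qed
  moreover have "continuous_map (powertop_real {..<n}) euclideanreal (\<lambda>x. f x + g x)"
    using Suc.prems[THEN Ck_continuous] by (rule continuous_map_add)
  ultimately show ?case
    by simp
qed (auto intro: continuous_map_add)

lemma Ck_mult: "Ck k n f \<Longrightarrow> Ck k n g \<Longrightarrow> Ck k n (\<lambda>x. f x * g x)"
proof (induction k arbitrary: f g)
  case (Suc k)
  have "\<exists>h'. Ck k n h' \<and> (\<forall>x\<in>RR n.
      ((\<lambda>t. f (x(i := t)) * g (x(i := t))) has_real_derivative h' x) (at (x i)))"
    if i: "i < n" for i
  proof -
    obtain f' where f': "Ck k n f'"
      "\<And>x. x \<in> RR n \<Longrightarrow> ((\<lambda>t. f (x(i := t))) has_real_derivative f' x) (at (x i))"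
      using Ck_partial[OF Suc.prems(1) i] by blast
    obtain g' where g': "Ck k n g'"
      "\<And>x. x \<in> RR n \<Longrightarrow> ((\<lambda>t. g (x(i := t))) has_real_derivative g' x) (at (x i))"
      using Ck_partial[OF Suc.prems(2) i] by blast
    have "((\<lambda>t. f (x(i := t)) * g (x(i := t))) has_real_derivative f' x * g x + g' x * f x) (at (x i))"
      if "x \<in> RR n" for x
      using DERIV_mult[OF f'(2) g'(2), OF that that] by simp
    then show ?thesis
      by (intro exI[of _ "\<lambda>x. f' x * g x + g' x * f x"] conjI Suc.IH Ck_add ballI f' g'
        Suc.prems[THEN Ck_lower])
  qed
  moreover have "continuous_map (powertop_real {..<n}) euclideanreal (\<lambda>x. f x * g x)"
    using Suc.prems[THEN Ck_continuous] by (rule continuous_map_real_mult)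
  ultimately show ?case
    by simp
qed (auto intro: continuous_map_real_mult)

text \<open>For one variable the only partial derivative is \<open>f'\<close>. The second part is
  the bootstrapping step: a function whose derivative is built from functions already of order
  \<open>k\<close> has order \<open>Suc k\<close>.\<close>

lemma Ck_univariate:
  assumes "\<And>t. (f has_real_derivative f' t) (at t)"
  shows Ck_0_univariate: "Ck 0 1 (\<lambda>x. f (x 0))"
    and Ck_Suc_univariate: "Ck k 1 (\<lambda>x. f' (x 0)) \<Longrightarrow> Ck (Suc k) 1 (\<lambda>x. f (x 0))"
proof -
  have "continuous_on UNIV f"
    using assms DERIV_isCont continuous_at_imp_continuous_on by blast
  then have "continuous_map euclideanreal euclideanreal f"
    by simp
  moreover have "continuous_map (powertop_real {..<1::nat}) euclideanreal (\<lambda>x. x 0)"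
    by (rule continuous_map_product_coordinates) simp
  ultimately show "Ck 0 1 (\<lambda>x. f (x 0))"
    unfolding Ck.simps using continuous_map_compose[unfolded o_def] by blast
  then show "Ck k 1 (\<lambda>x. f' (x 0)) \<Longrightarrow> Ck (Suc k) 1 (\<lambda>x. f (x 0))"
    using assms by (auto simp flip: One_nat_def)
qed

lemma smooth_restrict: "smooth n (restrict f (RR n)) \<longleftrightarrow> (\<forall>k. Ck k n f)"
  by (auto simp: smooth_def cong: Ck_cong)

lemma smooth_const: "smooth n (\<lambda>x\<in>RR n. c)"
  by (simp add: smooth_restrict Ck_const)

lemma smooth_add: "smooth n f \<Longrightarrow> smooth n g \<Longrightarrow> smooth n (\<lambda>x\<in>RR n. f x + g x)"
  and smooth_mult: "smooth n f \<Longrightarrow> smooth n g \<Longrightarrow> smooth n (\<lambda>x\<in>RR n. f x * g x)"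
  unfolding smooth_restrict by (simp_all add: smooth_def Ck_add Ck_mult)

section \<open>The two auxiliary smooth functions\<close>

definition tau :: "real \<Rightarrow> real"
  where "tau t = 1 / sqrt (1 + t\<^sup>2)"

definition rho :: "real \<Rightarrow> real"
  where "rho t = sqrt (t + sqrt (1 + t\<^sup>2))"

text \<open>Strict positivity of the radicand of \<open>rho\<close> keeps the outer root away from
  its singularity at zero, so that \<open>rho\<close> is differentiable on the whole line.\<close>

lemma sqrt_gt_neg: "0 < t + sqrt (1 + t\<^sup>2)" for t :: real
proof -
  have "\<bar>t\<bar> < sqrt (1 + t\<^sup>2)"
    by (rule real_less_rsqrt) simp
  then show ?thesis
    by linarith
qed

lemma tau_identity: "(1 + t * t) * (tau t * tau t) = 1"
proof -
  have "1 + t * t > 0" by (simp add: add_pos_nonneg)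
  then show ?thesis
    by (simp add: tau_def power2_eq_square)
qed

lemma rho_identity: "(rho t * rho t) * (rho t * rho t) = (t + t) * (rho t * rho t) + 1"
proof -
  have 1: "rho t * rho t = t + sqrt (1 + t\<^sup>2)"
    using sqrt_gt_neg[of t] by (simp add: rho_def)
  have "sqrt (1 + t\<^sup>2) * sqrt (1 + t\<^sup>2) = 1 + t * t"
    by (simp add: power2_eq_square)
  then show ?thesis unfolding 1 by (simp add: algebra_simps)
qed

text \<open>The derivative is written as a nested product of a constant, the variable and copies of
  \<open>tau\<close>, the form on which \<open>Ck_mult\<close> can be iterated in
  \<open>Ck_tau\<close>.\<close>

lemma tau_deriv: "(tau has_real_derivative (- 1) * (t * (tau t * (tau t * tau t)))) (at t)"
proof -
  have p: "1 + t\<^sup>2 > 0" by (simp add: add_pos_nonneg)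
  have "((\<lambda>t. 1 / sqrt (1 + t\<^sup>2)) has_real_derivative
      - (t / sqrt (1 + t\<^sup>2)) / (sqrt (1 + t\<^sup>2) * sqrt (1 + t\<^sup>2))) (at t)"
    using p by (auto intro!: derivative_eq_intros simp: field_simps)
  then show ?thesis
    by (simp add: tau_def[abs_def])
qed

text \<open>With \<open>s = sqrt (1 + t\<^sup>2)\<close> and \<open>rho t * rho t = t + s\<close>,
  the chain rule gives \<open>(1 + t / s) / (2 * rho t) = rho t / (2 * s)\<close>, and
  \<open>1 / s\<close> is \<open>tau t\<close>.\<close>

lemma rho_deriv: "(rho has_real_derivative (1 / 2) * (rho t * tau t)) (at t)"
proof -
  define s where "s = sqrt (1 + t\<^sup>2)"
  have p: "1 + t\<^sup>2 > 0" by (simp add: add_pos_nonneg)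
  have sp: "s > 0" "t + s > 0" using p sqrt_gt_neg[of t] by (auto simp: s_def)
  have "((\<lambda>t. sqrt (t + sqrt (1 + t\<^sup>2))) has_real_derivative
      (1 + t / s) * (inverse (sqrt (t + s)) / 2)) (at t)"
    unfolding s_def
    using p sqrt_gt_neg[of t] by (auto intro!: derivative_eq_intros simp: field_simps)
  also have "(1 + t / s) * (inverse (sqrt (t + s)) / 2) = (t + s) / sqrt (t + s) / (2 * s)"
    using sp by (simp add: field_simps)
  also have "\<dots> = sqrt (t + s) / (2 * s)"
    using sp by (simp add: real_div_sqrt)
  finally show ?thesis
    by (simp add: tau_def rho_def[abs_def] s_def)
qed

lemma Ck_tau: "Ck k 1 (\<lambda>x. tau (x 0))"
proof (induction k)
  case 0
  show ?case
    by (rule Ck_0_univariate[OF tau_deriv])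
next
  case (Suc k)
  then show ?case
    by (intro Ck_Suc_univariate[OF tau_deriv] Ck_mult Ck_const Ck_proj) auto
qed

lemma Ck_rho: "Ck k 1 (\<lambda>x. rho (x 0))"
proof (induction k)
  case 0
  show ?case
    by (rule Ck_0_univariate[OF rho_deriv])
next
  case (Suc k)
  then show ?case
    by (intro Ck_Suc_univariate[OF rho_deriv] Ck_mult Ck_const Ck_tau)
qed

section \<open>Transfer of identities between smooth functions to a C-infinity ring\<close>

context cinf_ring
begin

text \<open>Sum and product of the underlying ring are interpretations of binary functions at a
  \<open>pair\<close>, so both are covered by one instance of \<open>interp_comp\<close> with a
  family of two maps.\<close>

lemma interp_binary:
  assumes "smooth 2 (\<lambda>x\<in>RR 2. F (x 0) (x 1))" "smooth n f" "smooth n g" "a \<in> tuples n (carrier A)"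
  shows "interp A n (\<lambda>x\<in>RR n. F (f x) (g x)) a =
    interp A 2 (\<lambda>x\<in>RR 2. F (x 0) (x 1)) (pair (interp A n f a) (interp A n g a))"
proof -
  define p where "p i = (if i = 0 then f else g)" for i :: nat
  have "interp A n (\<lambda>x\<in>RR n. (\<lambda>x\<in>RR 2. F (x 0) (x 1)) (\<lambda>i\<in>{..<2}. p i x)) a =
      interp A 2 (\<lambda>x\<in>RR 2. F (x 0) (x 1)) (\<lambda>i\<in>{..<2}. interp A n (p i) a)"
    by (rule interp_comp[where h = "\<lambda>x\<in>RR 2. F (x 0) (x 1)" and g = p])
      (use assms in \<open>simp_all add: p_def\<close>)
  moreover have "(\<lambda>x\<in>RR n. (\<lambda>x\<in>RR 2. F (x 0) (x 1)) (\<lambda>i\<in>{..<2}. p i x)) =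
      (\<lambda>x\<in>RR n. F (f x) (g x))"
    by (rule restrict_ext) (simp add: p_def)
  moreover have "(\<lambda>i\<in>{..<2}. interp A n (p i) a) = pair (interp A n f a) (interp A n g a)"
    unfolding pair_def by (rule restrict_ext) (simp add: p_def)
  ultimately show ?thesis
    by simp
qed

lemma interp_add:
  assumes "smooth n f" "smooth n g" "a \<in> tuples n (carrier A)"
  shows "interp A n (\<lambda>x\<in>RR n. f x + g x) a =
    interp A n f a \<oplus>\<^bsub>underlying_ring A\<^esub> interp A n g a"
proof -
  have "smooth 2 (\<lambda>x\<in>RR 2. x 0 + x 1)"
    by (simp add: smooth_restrict Ck_add Ck_proj)
  from interp_binary[where F = "(+)", OF this assms] show ?thesis
    by (simp add: underlying_ring_def)
qed

lemma interp_mult: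
  assumes "smooth n f" "smooth n g" "a \<in> tuples n (carrier A)"
  shows "interp A n (\<lambda>x\<in>RR n. f x * g x) a =
    interp A n f a \<otimes>\<^bsub>underlying_ring A\<^esub> interp A n g a"
proof -
  have "smooth 2 (\<lambda>x\<in>RR 2. x 0 * x 1)"
    by (simp add: smooth_restrict Ck_mult Ck_proj)
  from interp_binary[where F = "(*)", OF this assms] show ?thesis
    by (simp add: underlying_ring_def)
qed

lemma interp_one:
  assumes "a \<in> tuples n (carrier A)"
  shows "interp A n (\<lambda>x\<in>RR n. 1) a = \<one>\<^bsub>underlying_ring A\<^esub>"
proof -
  \<comment> \<open>The constant 1 on \<open>RR n\<close> factors through the one-point space
    \<open>RR 0\<close>; no index lies below 0, so the inner family is arbitrary.\<close>
  have "interp A n (\<lambda>x\<in>RR n. (\<lambda>x\<in>RR 0. 1) (\<lambda>i\<in>{..<0}. (\<lambda>x. 0) x)) a =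
      interp A 0 (\<lambda>x\<in>RR 0. 1) (\<lambda>i\<in>{..<0}. interp A n (\<lambda>x. 0) a)"
    by (rule interp_comp[where h = "\<lambda>x\<in>RR 0. 1" and g = "\<lambda>i x. 0"])
      (use assms smooth_const[of 0] smooth_const[of n] in \<open>simp_all del: PiE_empty_domain lessThan_0\<close>)
  moreover have "(\<lambda>x\<in>RR n. (\<lambda>x\<in>RR 0. 1) (\<lambda>i\<in>{..<0}. (\<lambda>x. 0) x)) = (\<lambda>x\<in>RR n. 1 :: real)"
    by (rule restrict_ext) (simp add: restrict_def)
  \<comment> \<open>The empty restriction is exactly the 0-tuple at which
    \<open>underlying_ring\<close> evaluates its constants.\<close>
  moreover have "(\<lambda>i\<in>{..<0::nat}. interp A n (\<lambda>x. 0) a) = (\<lambda>i. undefined)"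
    by auto
  ultimately show ?thesis
    by (simp add: underlying_ring_def)
qed

text \<open>\<open>tau_identity\<close> is an equation between smooth functions of one variable;
  interpreting both sides at the 1-tuple \<open>w\<close> turns it into an equation in the ring,
  with \<open>t\<close> the value of \<open>tau\<close> at \<open>w\<close>.\<close>

lemma inverse_root_in_cinf_ring:
  fixes R (structure)
  defines "R \<equiv> underlying_ring A"
  assumes "w \<in> carrier A"
  shows "\<exists>t\<in>carrier A. (\<one> \<oplus> w \<otimes> w) \<otimes> (t \<otimes> t) = \<one>"
proof -
  define a where "a = (\<lambda>i\<in>{..<1::nat}. w)"
  have a: "a \<in> tuples 1 (carrier A)"
    using assms by (simp add: a_def)
  define X where "X = (\<lambda>x\<in>RR 1. x 0)"
  define T where "T = (\<lambda>x\<in>RR 1. tau (x 0))"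
  have X: "smooth 1 X" and T: "smooth 1 T"
    by (simp_all add: X_def T_def smooth_restrict Ck_proj Ck_tau del: One_nat_def)
  \<comment> \<open>Every subterm carries its own restriction, so that \<open>interp_add\<close> and
    \<open>interp_mult\<close> match it literally.\<close>
  have "(\<lambda>x\<in>RR 1. 1) =
    (\<lambda>x\<in>RR 1. (\<lambda>x\<in>RR 1. (\<lambda>x\<in>RR 1. 1) x + (\<lambda>x\<in>RR 1. X x * X x) x) x * (\<lambda>x\<in>RR 1. T x * T x) x)"
    by (auto simp: X_def T_def tau_identity)
  then have "interp A 1 (\<lambda>x\<in>RR 1. 1) a = interp A 1 \<dots> a"
    by (rule arg_cong)
  moreover have "interp A 1 X a = w"
    using interp_proj[OF _ a, of 0] by (simp add: X_def a_def)
  ultimately have "(\<one> \<oplus> w \<otimes> w) \<otimes> (interp A 1 T a \<otimes> interp A 1 T a) = \<one>"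
    by (simp only: interp_mult interp_add interp_one R_def smooth_add smooth_mult smooth_const X T a)
  with interp_closed[OF T a] show ?thesis
    by blast
qed

text \<open>The same transfer, applied to \<open>rho_identity\<close>.\<close>

lemma quartic_root_in_cinf_ring:
  fixes R (structure)
  defines "R \<equiv> underlying_ring A"
  assumes "s \<in> carrier A"
  shows "\<exists>r\<in>carrier A.
    (r \<otimes> r) \<otimes> (r \<otimes> r) = (s \<oplus> s) \<otimes> (r \<otimes> r) \<oplus> \<one>"
proof -
  define a where "a = (\<lambda>i\<in>{..<1::nat}. s)"
  have a: "a \<in> tuples 1 (carrier A)"
    using assms by (simp add: a_def)
  define X where "X = (\<lambda>x\<in>RR 1. x 0)"
  define P where "P = (\<lambda>x\<in>RR 1. rho (x 0))"
  have X: "smooth 1 X" and P: "smooth 1 P"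
    by (simp_all add: X_def P_def smooth_restrict Ck_proj Ck_rho del: One_nat_def)
  define P2 where "P2 = (\<lambda>x\<in>RR 1. P x * P x)"
  have "(\<lambda>x\<in>RR 1. P2 x * P2 x) =
    (\<lambda>x\<in>RR 1. (\<lambda>x\<in>RR 1. (\<lambda>x\<in>RR 1. X x + X x) x * P2 x) x + (\<lambda>x\<in>RR 1. 1) x)"
    by (auto simp: X_def P_def P2_def rho_identity)
  then have "interp A 1 (\<lambda>x\<in>RR 1. P2 x * P2 x) a = interp A 1 \<dots> a"
    by (rule arg_cong)
  moreover have "interp A 1 X a = s"
    using interp_proj[OF _ a, of 0] by (simp add: X_def a_def)
  moreover have "smooth 1 P2"
    unfolding P2_def by (rule smooth_mult[OF P P])
  moreover have "interp A 1 P2 a = interp A 1 P a \<otimes> interp A 1 P a"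
    unfolding P2_def R_def by (rule interp_mult[OF P P a])
  ultimately show ?thesis
    using interp_closed[OF P a]
    by (intro bexI[of _ "interp A 1 P a"])
      (simp_all only: interp_mult interp_add interp_one R_def smooth_add smooth_mult smooth_const X a)
qed

end

section \<open>Squares of units in a field with the two transferred root properties\<close>

locale field_with_roots = field +
  assumes ex_inverse_root: "w \<in> carrier R \<Longrightarrow> \<exists>t\<in>carrier R. (\<one> \<oplus> w \<otimes> w) \<otimes> (t \<otimes> t) = \<one>"
    and ex_quartic_root: "s \<in> carrier R \<Longrightarrow>
      \<exists>r\<in>carrier R. (r \<otimes> r) \<otimes> (r \<otimes> r) = (s \<oplus> s) \<otimes> (r \<otimes> r) \<oplus> \<one>"
begin

text \<open>Dividing by the square of \<open>v\<close> reduces the sum to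
  \<open>1 + w\<^sup>2\<close> with \<open>w = u / v\<close>, which is the square of
  \<open>1 / t\<close>; the required root is \<open>v / t\<close>.\<close>

lemma sum_of_unit_squares:
  assumes u: "u \<in> Units R" and v: "v \<in> Units R"
  obtains w where "w \<in> Units R" "u \<otimes> u \<oplus> v \<otimes> v = w \<otimes> w"
proof -
  have c: "u \<in> carrier R" "v \<in> carrier R" "inv v \<in> carrier R" and vv: "v \<otimes> inv v = \<one>"
    using u v by auto
  define w where "w = u \<otimes> inv v"
  have wc: "w \<in> carrier R" and vw: "v \<otimes> w = u"
    using c vv by (simp_all add: w_def m_lcomm)
  obtain t where tc: "t \<in> carrier R" and t: "(\<one> \<oplus> w \<otimes> w) \<otimes> (t \<otimes> t) = \<one>"
    using ex_inverse_root[OF wc] by blast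
  have tU: "t \<in> Units R"
    using t tc wc by (auto simp: field_Units)
  define y where "y = inv t"
  have yU: "y \<in> Units R" and yc: "y \<in> carrier R" and ty: "t \<otimes> y = \<one>"
    using tU by (auto simp: y_def)
  \<comment> \<open>The inserted factor is 1; it supplies the two copies of \<open>t\<close> that
    cancel \<open>\<one> \<oplus> w \<otimes> w\<close>.\<close>
  have "u \<otimes> u \<oplus> v \<otimes> v = (v \<otimes> v) \<otimes> (\<one> \<oplus> w \<otimes> w) \<otimes> ((t \<otimes> y) \<otimes> (t \<otimes> y))"
    unfolding ty vw[symmetric] using c wc by algebra
  also have "\<dots> = ((\<one> \<oplus> w \<otimes> w) \<otimes> (t \<otimes> t)) \<otimes> ((v \<otimes> y) \<otimes> (v \<otimes> y))"
    using c wc tc yc by (simp add: m_ac)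
  also have "\<dots> = (v \<otimes> y) \<otimes> (v \<otimes> y)"
    unfolding t using c yc by simp
  finally show thesis
    using that[of "v \<otimes> y"] v yU by simp
qed

lemma square_or_minus_square:
  assumes a: "a \<in> carrier R" and "a \<noteq> \<zero>"
  obtains u where "u \<in> Units R" "a = u \<otimes> u \<or> \<ominus> a = u \<otimes> u"
proof -
  \<comment> \<open>At \<open>w = 1\<close> the property reads \<open>2 t\<^sup>2 = 1\<close>, so
    \<open>t \<otimes> t\<close> serves as one half and the characteristic is not 2.\<close>
  obtain t where tc: "t \<in> carrier R" and t: "(\<one> \<oplus> \<one> \<otimes> \<one>) \<otimes> (t \<otimes> t) = \<one>"
    using ex_inverse_root[of \<one>] by auto
  have aU: "a \<in> Units R"
    using assms by (simp add: field_Units)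
  define b where "b = inv a"
  have b: "b \<in> carrier R" and ab: "a \<otimes> b = \<one>"
    using aU by (auto simp: b_def)
  define s where "s = (t \<otimes> t) \<otimes> (a \<ominus> b)"
  have sc: "s \<in> carrier R"
    using a b tc by (simp add: s_def)
  have "s \<oplus> s = ((\<one> \<oplus> \<one> \<otimes> \<one>) \<otimes> (t \<otimes> t)) \<otimes> (a \<ominus> b)"
    unfolding s_def using a b tc by algebra
  then have s: "s \<oplus> s = a \<ominus> b"
    unfolding t using a b by simp
  obtain r where r: "r \<in> carrier R"
    and q: "(r \<otimes> r) \<otimes> (r \<otimes> r) = (s \<oplus> s) \<otimes> (r \<otimes> r) \<oplus> \<one>"
    using ex_quartic_root[OF sc] by blast
  \<comment> \<open>The quartic equation says that the square of \<open>r\<close> is a root of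
    \<open>X\<^sup>2 - (a - b) X - a b\<close>, because \<open>a \<otimes> b = \<one>\<close>; the
    roots of this polynomial are \<open>a\<close> and \<open>- b\<close>.\<close>
  have "(r \<otimes> r \<ominus> a) \<otimes> (r \<otimes> r \<oplus> b) = (r \<otimes> r) \<otimes> (r \<otimes> r) \<ominus> ((a \<ominus> b) \<otimes> (r \<otimes> r) \<oplus> a \<otimes> b)"
    using a b r by algebra
  also have "\<dots> = \<zero>"
    unfolding q s ab using a b r by algebra
  finally consider "r \<otimes> r \<ominus> a = \<zero>" | "r \<otimes> r \<oplus> b = \<zero>"
    using a b r integral by (metis a_closed m_closed minus_closed)
  then show thesis
  proof cases
    case 1
    then have "a = r \<otimes> r"
      using a r by simp
    moreover from this have "r \<in> Units R"
      using r assms by (auto simp: field_Units)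
    ultimately show thesis
      using that by blast
  next
    case 2
    \<comment> \<open>Here the square of \<open>r\<close> is \<open>- b\<close>, and multiplying by
      the square of \<open>a\<close> turns \<open>- b\<close> into \<open>- a\<close>.\<close>
    have "(a \<otimes> r) \<otimes> (a \<otimes> r) = (a \<otimes> a) \<otimes> (r \<otimes> r \<oplus> b) \<ominus> a \<otimes> (a \<otimes> b)"
      using a b r by algebra
    also have "\<dots> = \<ominus> a"
      unfolding 2 ab using a by algebra
    finally have "\<ominus> a = (a \<otimes> r) \<otimes> (a \<otimes> r)" ..
    moreover from this have "a \<otimes> r \<in> Units R"
      using a r assms by (auto simp: field_Units)
    ultimately show thesis
      using that by blast
  qed
qed

end

text \<open>After this point smooth functions no longer occur: the order axioms follow from field
  algebra and the two root properties.\<close>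

lemma cinf_field_with_roots:
  assumes "cinf_field A"
  shows "field_with_roots (underlying_ring A)"
proof -
  interpret cinf_field A by fact
  interpret field "underlying_ring A" by (rule field_underlying_ring)
  have "carrier (underlying_ring A) = carrier A"
    by (simp add: underlying_ring_def)
  then show ?thesis
    by unfold_locales (simp_all add: inverse_root_in_cinf_ring quartic_root_in_cinf_ring)
qed

section \<open>The order axioms\<close>

theorem theorem4p3:
  fixes A :: "'a cinf_structure"
  defines "R \<equiv> underlying_ring A"
  assumes "cinf_field A"
  shows "field R
    \<and> reflp_on (carrier A) (cinf_le A)
    \<and> transp_on (carrier A) (cinf_le A)
    \<and> antisymp_on (carrier A) (cinf_le A)
    \<and> (\<forall>a\<in>carrier A. \<forall>b\<in>carrier A. \<forall>x\<in>carrier A.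
         cinf_le A a b \<longrightarrow> cinf_le A (a \<oplus>\<^bsub>R\<^esub> x) (b \<oplus>\<^bsub>R\<^esub> x))
    \<and> (\<forall>a\<in>carrier A. \<forall>b\<in>carrier A. \<forall>x\<in>carrier A.
         cinf_le A a b \<longrightarrow> cinf_le A \<zero>\<^bsub>R\<^esub> x \<longrightarrow> cinf_le A (a \<otimes>\<^bsub>R\<^esub> x) (b \<otimes>\<^bsub>R\<^esub> x))
    \<and> (\<forall>a\<in>carrier A. \<forall>b\<in>carrier A.
         (a = b \<and> \<not> cinf_less A a b \<and> \<not> cinf_less A b a) \<or>
         (a \<noteq> b \<and> cinf_less A a b \<and> \<not> cinf_less A b a) \<or>
         (a \<noteq> b \<and> \<not> cinf_less A a b \<and> cinf_less A b a))"
proof -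
  interpret field_with_roots R
    unfolding R_def by (rule cinf_field_with_roots) fact
  have car: "carrier A = carrier R"
    by (simp add: R_def underlying_ring_def)
  have less_iff: "cinf_less A a b \<longleftrightarrow> (\<exists>u\<in>Units R. b \<ominus>\<^bsub>R\<^esub> a = u \<otimes>\<^bsub>R\<^esub> u)" for a b
    by (auto simp: cinf_less_def R_def[symmetric] numeral_2_eq_2 Units_closed)
  \<comment> \<open>Otherwise zero would be the square of a unit, which a field excludes.\<close>
  have irrefl: "\<not> cinf_less A a a" if "a \<in> carrier R" for a
  proof -
    have "a \<ominus>\<^bsub>R\<^esub> a = \<zero>\<^bsub>R\<^esub>"
      using that by simp
    then show ?thesis
      by (auto simp: less_iff field_Units dest!: integral[OF sym])
  qed
  have trans: "cinf_less A a c"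
    if "cinf_less A a b" "cinf_less A b c" "a \<in> carrier R" "b \<in> carrier R" "c \<in> carrier R"
    for a b c
  proof -
    obtain u v where uv: "u \<in> Units R" "v \<in> Units R"
      and eqs: "b \<ominus>\<^bsub>R\<^esub> a = u \<otimes>\<^bsub>R\<^esub> u" "c \<ominus>\<^bsub>R\<^esub> b = v \<otimes>\<^bsub>R\<^esub> v"
      using \<open>cinf_less A a b\<close> \<open>cinf_less A b c\<close> by (auto simp: less_iff)
    \<comment> \<open>The swapped order of \<open>u\<close> and \<open>v\<close> matches the
      decomposition of \<open>c - a\<close> as \<open>(c - b) + (b - a)\<close>.\<close>
    obtain w where w: "w \<in> Units R" "v \<otimes>\<^bsub>R\<^esub> v \<oplus>\<^bsub>R\<^esub> u \<otimes>\<^bsub>R\<^esub> u = w \<otimes>\<^bsub>R\<^esub> w"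
      using sum_of_unit_squares[OF uv(2,1)] .
    have "c \<ominus>\<^bsub>R\<^esub> a = (c \<ominus>\<^bsub>R\<^esub> b) \<oplus>\<^bsub>R\<^esub> (b \<ominus>\<^bsub>R\<^esub> a)"
      using that(3-5) by algebra
    with w eqs show ?thesis
      by (auto simp: less_iff)
  qed
  have asym: "\<not> cinf_less A b a" if "cinf_less A a b" "a \<in> carrier R" "b \<in> carrier R" for a b
    using trans irrefl that by blast
  \<comment> \<open>Either \<open>b - a\<close> or its negative \<open>a - b\<close> is the square
    of a unit.\<close>
  have total: "cinf_less A a b \<or> cinf_less A b a"
    if "a \<noteq> b" and ab: "a \<in> carrier R" "b \<in> carrier R" for a b
  proof -
    have "b \<ominus>\<^bsub>R\<^esub> a \<noteq> \<zero>\<^bsub>R\<^esub>"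
      using that by (metis r_right_minus_eq)
    then obtain u where "u \<in> Units R"
      "b \<ominus>\<^bsub>R\<^esub> a = u \<otimes>\<^bsub>R\<^esub> u \<or> \<ominus>\<^bsub>R\<^esub> (b \<ominus>\<^bsub>R\<^esub> a) = u \<otimes>\<^bsub>R\<^esub> u"
      using square_or_minus_square ab minus_closed by metis
    moreover have "\<ominus>\<^bsub>R\<^esub> (b \<ominus>\<^bsub>R\<^esub> a) = a \<ominus>\<^bsub>R\<^esub> b"
      using ab by (simp add: minus_eq minus_add a_comm)
    ultimately show ?thesis
      by (auto simp: less_iff)
  qed
  have add: "cinf_less A (a \<oplus>\<^bsub>R\<^esub> x) (b \<oplus>\<^bsub>R\<^esub> x)"
    if "cinf_less A a b" "a \<in> carrier R" "b \<in> carrier R" "x \<in> carrier R" for a b x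
  proof -
    have "(b \<oplus>\<^bsub>R\<^esub> x) \<ominus>\<^bsub>R\<^esub> (a \<oplus>\<^bsub>R\<^esub> x) = b \<ominus>\<^bsub>R\<^esub> a"
      using that(2-4) by algebra
    with that(1) show ?thesis
      by (simp add: less_iff)
  qed
  have mult: "cinf_less A (a \<otimes>\<^bsub>R\<^esub> x) (b \<otimes>\<^bsub>R\<^esub> x)"
    if "cinf_less A a b" "cinf_less A \<zero>\<^bsub>R\<^esub> x" and ab: "a \<in> carrier R" "b \<in> carrier R"
      and x: "x \<in> carrier R" for a b x
  proof -
    have "x \<ominus>\<^bsub>R\<^esub> \<zero>\<^bsub>R\<^esub> = x"
      using x by (simp add: minus_eq)
    then obtain u v where uv: "u \<in> Units R" "v \<in> Units R"
      and eqs: "b \<ominus>\<^bsub>R\<^esub> a = u \<otimes>\<^bsub>R\<^esub> u" "x = v \<otimes>\<^bsub>R\<^esub> v"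
      using \<open>cinf_less A a b\<close> \<open>cinf_less A \<zero>\<^bsub>R\<^esub> x\<close> by (auto simp: less_iff)
    \<comment> \<open>The difference of the products is a product of two unit squares, hence the
      square of the unit \<open>u \<otimes> v\<close>.\<close>
    have "b \<otimes>\<^bsub>R\<^esub> x \<ominus>\<^bsub>R\<^esub> a \<otimes>\<^bsub>R\<^esub> x = (b \<ominus>\<^bsub>R\<^esub> a) \<otimes>\<^bsub>R\<^esub> x"
      using ab x by (simp add: minus_eq l_distr l_minus)
    also have "\<dots> = (u \<otimes>\<^bsub>R\<^esub> v) \<otimes>\<^bsub>R\<^esub> (u \<otimes>\<^bsub>R\<^esub> v)"
      unfolding eqs using uv[THEN Units_closed] by (simp add: m_ac)
    finally show ?thesis
      using uv by (auto simp: less_iff)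
  qed
  show ?thesis
    unfolding car
  proof (intro conjI ballI impI)
    show "field R"
      by (rule field_axioms)
    show "reflp_on (carrier R) (cinf_le A)"
      by (simp add: reflp_on_def cinf_le_def)
    show "transp_on (carrier R) (cinf_le A)"
      unfolding transp_on_def cinf_le_def using trans by blast
    show "antisymp_on (carrier R) (cinf_le A)"
      unfolding antisymp_on_def cinf_le_def using asym by blast
  next
    fix a b x
    assume abx: "a \<in> carrier R" "b \<in> carrier R" "x \<in> carrier R" and le: "cinf_le A a b"
    show "cinf_le A (a \<oplus>\<^bsub>R\<^esub> x) (b \<oplus>\<^bsub>R\<^esub> x)"
      using le add abx by (auto simp: cinf_le_def)
    \<comment> \<open>If \<open>a = b\<close> or \<open>x\<close> is zero, the two products
      coincide; only the doubly strict case needs \<open>mult\<close>.\<close>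
    assume "cinf_le A \<zero>\<^bsub>R\<^esub> x"
    then show "cinf_le A (a \<otimes>\<^bsub>R\<^esub> x) (b \<otimes>\<^bsub>R\<^esub> x)"
      using le mult abx by (auto simp: cinf_le_def)
  next
    fix a b
    assume "a \<in> carrier R" "b \<in> carrier R"
    then show "(a = b \<and> \<not> cinf_less A a b \<and> \<not> cinf_less A b a) \<or>
         (a \<noteq> b \<and> cinf_less A a b \<and> \<not> cinf_less A b a) \<or>
         (a \<noteq> b \<and> \<not> cinf_less A a b \<and> cinf_less A b a)"
      using irrefl asym total by blast
  qed
qed

end
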